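(* Let $n\ge1$ and let $\pi,\sigma\in\mathcal{S}_n$ be $1\text{-}3\text{-}2$-avoiding permutations. Then $\Lambda(\pi)\subset\Lambda(\sigma)$ (proper containment of Young diagrams) if and only if $\pi<\sigma$ in the (strong) Bruhat order on $\mathcal{S}_n$.
   Context: $\mathcal{S}_n$ is the set of permutations $\pi=\pi_1\cdots\pi_n$ of $[n]=\{1,\ldots,n\}$, written as words. A permutation $\pi$ avoids $1\text{-}3\text{-}2$ if there are no $i<j<k$ with $\pi_i<\pi_k<\pi_j$. The standardization $w^{\ast}$ of a word $w$ of $m$ distinct positive integers is the permutation in $\mathcal{S}_m$ obtained by replacing the $i$th smallest letter by $i$. The map $D$ from permutations in $\mathcal{S}_n$ to Dyck words of length $2n$ in the letters $\mathsf{u}$ (up step $(0,1)$) and $\mathsf{r}$ (right step $(1,0)$) is defined recursively by $D(\emptyset)=\emptyset$ and, for $\pi=\pi_L\,n\,\pi_R\in\mathcal{S}_n$ with $n\ge1$ ($\pi_L,\pi_R$ the possibly empty words to the left and right of the letter $n$), $D(\pi)=\mathsf{u}\,D(\pi_L^{\ast})\,\mathsf{r}\,D(\pi_R^{\ast})$. $\Lambda(\pi)$ is the partition with exactly $n-1$ parts (parts equal to $0$ allowed) whose Young diagram is the region above the path $D(\pi)$ drawn from $(0,0)$ to $(n,n)$. Equivalently, the parts of $\Lambda(\pi)$ are, in weakly decreasing order, the numbers of letters $\mathsf{r}$ preceding the 2nd, 3rd, ..., $n$th letter $\mathsf{u}$ in $D(\pi)$. Containment of partitions is containment of Young diagrams,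 i.e. partwise $\le$. The strong Bruhat order on $\mathcal{S}_n$ is the partial order whose covering relations are: $\pi$ is covered by $\sigma$ if $\sigma$ is obtained from $\pi$ by exchanging the entries in positions $i<j$ with $\pi_i<\pi_j$ and $\sigma$ has exactly one more inversion than $\pi$. *)

theory Defs
  imports "HOL-Combinatorics.Multiset_Permutations"
begin

text \<open>Permutations are words: lists of natural numbers, with positions counted from \<open>0\<close>
  and letters from \<open>1\<close>.\<close>

abbreviation perms :: "nat \<Rightarrow> nat list set" where
  "perms n \<equiv> permutations_of_set {1..n}"

definition avoids_132 :: "nat list \<Rightarrow> bool" where
  "avoids_132 w \<longleftrightarrow>
     \<not> (\<exists>i j k. i < j \<and> j < k \<and> k < length w \<and> w ! i < w ! k \<and> w ! k < w ! j)"

definition standardize :: "nat list \<Rightarrow> nat list" where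
  "standardize w = map (\<lambda>x. card {y \<in> set w. y \<le> x}) w"

lemma length_standardize [simp]: "length (standardize w) = length w"
  by (simp add: standardize_def)

text \<open>\<open>Up\<close> is the step \<open>(0,1)\<close>, \<open>Rt\<close> the step \<open>(1,0)\<close>.\<close>

datatype step = Up | Rt

text \<open>A nonempty word is split at its largest letter, which for a word in \<open>perms n\<close> is \<open>n\<close>;
  taking the maximum makes the recursion terminate on all lists.\<close>

function dyck :: "nat list \<Rightarrow> step list" where
  "dyck [] = []"
| "w \<noteq> [] \<Longrightarrow> dyck w =
     Up # dyck (standardize (takeWhile (\<lambda>x. x \<noteq> Max (set w)) w))
     @ Rt # dyck (standardize (tl (dropWhile (\<lambda>x. x \<noteq> Max (set w)) w)))"
  by auto
termination
proof (relation "measure length", goal_cases)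
  case 1
  show ?case by simp
next
  case (2 w)
  then have "Max (set w) \<in> set w" by simp
  then have "dropWhile (\<lambda>x. x \<noteq> Max (set w)) w \<noteq> []" by simp
  moreover have "length w = length (takeWhile (\<lambda>x. x \<noteq> Max (set w)) w)
      + length (dropWhile (\<lambda>x. x \<noteq> Max (set w)) w)"
    by (metis length_append takeWhile_dropWhile_id)
  ultimately show ?case by simp
next
  case (3 w)
  then show ?case
    using length_dropWhile_le[of "\<lambda>x. x \<noteq> Max (set w)" w] by (cases w) auto
qed

text \<open>One entry for each letter \<open>Up\<close>, in order: the number of letters \<open>Rt\<close> preceding it, which
  is the number of unit cells of the square to the left of that up step.\<close>

definition rights_before_ups :: "step list \<Rightarrow> nat list" where
  "rights_before_ups p =
     map (\<lambda>i. count_list (take i p) Rt) (filter (\<lambda>i. p ! i = Up) [0..<length p])"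

text \<open>The row of the first up step is dropped by \<open>tl\<close>; reversal lists the parts from the top row
  down, that is, in weakly decreasing order.\<close>

definition Lam :: "nat list \<Rightarrow> nat list" where
  "Lam w = rev (tl (rights_before_ups (dyck w)))"

definition young_diagram :: "nat list \<Rightarrow> (nat \<times> nat) set" where
  "young_diagram \<mu> = {(i, j). i < length \<mu> \<and> j < \<mu> ! i}"

definition inversions :: "nat list \<Rightarrow> (nat \<times> nat) set" where
  "inversions w = {(i, j). i < j \<and> j < length w \<and> w ! j < w ! i}"

definition bruhat_covered :: "nat \<Rightarrow> nat list \<Rightarrow> nat list \<Rightarrow> bool" where
  "bruhat_covered n v w \<longleftrightarrow> v \<in> perms n \<and> w \<in> perms n \<and>
     (\<exists>i j. i < j \<and> j < n \<and> v ! i < v ! j \<and> w = v[i := v ! j, j := v ! i]) \<and>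
     card (inversions w) = card (inversions v) + 1"

definition bruhat_le :: "nat \<Rightarrow> nat list \<Rightarrow> nat list \<Rightarrow> bool" where
  "bruhat_le n = (bruhat_covered n)\<^sup>*\<^sup>*"

definition bruhat_less :: "nat \<Rightarrow> nat list \<Rightarrow> nat list \<Rightarrow> bool" where
  "bruhat_less n v w \<longleftrightarrow> bruhat_le n v w \<and> v \<noteq> w"

end

theory Submission
  imports Defs
begin

text \<open>For a 132-avoiding \<open>\<pi>\<close> every letter left of the maximum exceeds every letter right of it, so
  the up steps of \<open>dyck \<pi>\<close> correspond to the letters in decreasing order and the right steps to the
  positions in increasing order. Hence the part of \<open>Lam \<pi>\<close> belonging to the letter \<open>a\<close> is the length of
  the longest prefix of \<open>\<pi>\<close> whose entries all exceed \<open>a\<close>, and containment of diagrams says that the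
  prefix minima of \<open>\<pi>\<close> are at most those of \<open>\<sigma>\<close>. A Bruhat cover can only raise prefix minima.
  Conversely, if \<open>w\<close> is any permutation whose prefix minima are at least those of \<open>\<pi>\<close>, then \<open>w\<close>
  exceeds \<open>\<pi>\<close> at the first position \<open>d\<close> where they differ, and moving the letter \<open>\<pi> ! d\<close> of \<open>w\<close> to the left by
  a suitable transposition gives an element covered by \<open>w\<close> with the same property.\<close>

section \<open>Inversions under an exchange of two entries\<close>

text \<open>The pair \<open>(i, j)\<close> becomes an inversion; the other pairs of positions are
  matched by an involution that carries the inversions of \<open>v\<close> to those of the exchanged
  word.\<close>

lemma inversions_swap_card:
  fixes v :: "nat list"
  assumes ij: "i < j" "j < length v" and lt: "v ! i < v ! j" and dist: "distinct v"
    and no: "\<And>k. i < k \<Longrightarrow> k < j \<Longrightarrow> \<not> (v ! i < v ! k \<and> v ! k < v ! j)"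
  shows "card (inversions (v[i := v ! j, j := v ! i])) = card (inversions v) + 1"
proof -
  define w where "w = v[i := v ! j, j := v ! i]"
  define t where "t p = (if p = i then j else if p = j then i else p)" for p
  \<comment> \<open>\<open>t\<close> may be applied to an inversion only if it keeps the order of the two positions: this is the
    case when the other position lies outside the interval from \<open>i\<close> to \<open>j\<close>.\<close>
  define f where "f = (\<lambda>(p, q). if p < i then (p, t q) else if j < q then (t p, q) else (p, q))"
  have w_nth: "w ! p = v ! t p" if "p < length v" for p
    using that ij by (auto simp: w_def t_def nth_list_update)
  have len: "length w = length v" by (simp add: w_def)
  have inj: "v ! p = v ! q \<longleftrightarrow> p = q" if "p < length v" "q < length v" for p q
    using that dist by (simp add: nth_eq_iff_index_eq)
  \<comment> \<open>So \<open>v ! k\<close> lies on the same side of both exchanged letters, and its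
    pairs with positions \<open>i\<close> and \<open>j\<close> keep their status.\<close>
  have no': "v ! k < v ! i \<longleftrightarrow> v ! k < v ! j" if "i < k" "k < j" for k
    using no[OF that] inj[of i k] that ij lt by fastforce
  have fin: "finite (inversions u)" for u
    by (rule finite_subset[of _ "{..<length u} \<times> {..<length u}"]) (auto simp: inversions_def)
  have t_t: "t (t p) = p" and t_less: "p < length v \<Longrightarrow> t p < length v" for p
    using ij by (auto simp: t_def)
  have t_left: "t p = p" "p < t q" if "p < i" "p < q" for p q
    using that ij by (auto simp: t_def)
  have t_right: "t q = q" "t p < q" if "j < q" "p < q" for p q
    using that ij by (auto simp: t_def)
  have f_f: "f (f (p, q)) = (p, q)" if "p < q" for p q
    using that ij t_left[of p q] t_right[of q p] t_t[of p]
    by (auto simp: f_def t_t) (auto simp: t_def split: if_splits)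
  \<comment> \<open>\<open>v ! t q < v ! t p\<close> says that \<open>(p, q)\<close> is an inversion
    of \<open>w\<close>. As \<open>f\<close> is an involution, this one equivalence serves both
    inclusions below.\<close>
  have f_pair: "\<exists>a b. f (p, q) = (a, b) \<and> a < b \<and> b < length v \<and> (a, b) \<noteq> (i, j) \<and>
      (v ! b < v ! a \<longleftrightarrow> v ! t q < v ! t p)"
    if pq: "p < q" "q < length v" "(p, q) \<noteq> (i, j)" for p q
  proof -
    consider (left) "p < i" | (right) "\<not> p < i" "j < q" | (mid) "i \<le> p" "q \<le> j" by linarith
    then show ?thesis
    proof cases
      case left
      then show ?thesis using pq t_left[of p q] t_less[of q] by (auto simp: f_def)
    next
      case right
      then show ?thesis using pq ij t_right[of q p] by (auto simp: f_def)
    next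
      case mid
      then have "f (p, q) = (p, q)" by (simp add: f_def)
      moreover have "v ! q < v ! p \<longleftrightarrow> v ! t q < v ! t p"
      proof (cases "p = i")
        case True
        then have "q \<noteq> i" "q \<noteq> j" using pq by auto
        then show ?thesis using no'[of q] True mid pq by (simp add: t_def)
      next
        case False
        show ?thesis
        proof (cases "q = j")
          case True
          then have "v ! p < v ! i \<longleftrightarrow> v ! p < v ! j" "v ! p \<noteq> v ! i" "v ! p \<noteq> v ! j"
            using no'[of p] False mid pq inj[of p i] inj[of p j] by auto
          then show ?thesis using True False pq by (auto simp: t_def)
        next
          case q: False
          then show ?thesis using False mid pq by (simp add: t_def)
        qed
      qed
      ultimately show ?thesis using pq by simp
    qed
  qed
  have "bij_betw f (inversions v) (inversions w - {(i, j)})"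
  proof (rule bij_betw_byWitness[where f' = f])
    show "\<forall>a\<in>inversions v. f (f a) = a" "\<forall>a\<in>inversions w - {(i, j)}. f (f a) = a"
      using f_f by (auto simp: inversions_def)
    show "f ` inversions v \<subseteq> inversions w - {(i, j)}"
    proof
      fix x assume "x \<in> f ` inversions v"
      then obtain p q where x: "x = f (p, q)" and pq: "p < q" "q < length v" "v ! q < v ! p"
        by (auto simp: inversions_def)
      moreover have "(p, q) \<noteq> (i, j)" using pq lt by auto
      ultimately obtain a b where ab: "x = (a, b)" "a < b" "b < length v" "(a, b) \<noteq> (i, j)"
        using f_pair[of p q] by auto
      then have "f (a, b) = (p, q)" using f_f[OF pq(1)] x by simp
      then have "w ! b < w ! a" using f_pair[of a b] ab pq by (simp add: w_nth)
      then show "x \<in> inversions w - {(i, j)}" using ab by (simp add: inversions_def len)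
    qed
    show "f ` (inversions w - {(i, j)}) \<subseteq> inversions v"
    proof
      fix x assume "x \<in> f ` (inversions w - {(i, j)})"
      then obtain p q where "x = f (p, q)" "(p, q) \<in> inversions w" "(p, q) \<noteq> (i, j)" by auto
      moreover from this have "p < q" "q < length v" "v ! t q < v ! t p"
        by (auto simp: inversions_def len w_nth)
      ultimately show "x \<in> inversions v"
        using f_pair[of p q] by (auto simp: inversions_def)
    qed
  qed
  then have "card (inversions v) = card (inversions w - {(i, j)})"
    by (rule bij_betw_same_card)
  moreover have "(i, j) \<in> inversions w"
    using ij lt by (simp add: inversions_def len w_nth t_def)
  ultimately show ?thesis
    using card_Suc_Diff1[OF fin, of "(i, j)" w] by (simp add: w_def)
qed

section \<open>Prefix minima and the Bruhat order\<close>

text \<open>For words of equal length this compares the minima of all prefixes, stated entrywise so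
  that one position \<open>q\<close> is enough as a witness.\<close>

definition prefix_le :: "nat list \<Rightarrow> nat list \<Rightarrow> bool" where
  "prefix_le v w \<longleftrightarrow> (\<forall>p<length w. \<exists>q\<le>p. v ! q \<le> w ! p)"

lemma prefix_le_trans:
  assumes "prefix_le u v" "prefix_le v w" "length v = length w"
  shows "prefix_le u w"
  unfolding prefix_le_def
proof (intro allI impI)
  fix p assume p: "p < length w"
  then obtain q where q: "q \<le> p" "v ! q \<le> w ! p" using assms(2) by (auto simp: prefix_le_def)
  then have "q < length v" using p assms(3) by simp
  then obtain r where "r \<le> q" "u ! r \<le> v ! q" using assms(1) by (auto simp: prefix_le_def)
  with q show "\<exists>q\<le>p. u ! q \<le> w ! p" by (meson le_trans)
qed

lemma length_perms: "w \<in> perms n \<Longrightarrow> length w = n"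
  using distinct_card[of w] by (simp add: permutations_of_set_def)

lemma bruhat_covered_prefix_le:
  assumes "bruhat_covered n v w"
  shows "prefix_le v w"
proof -
  obtain i j where ij: "i < j" "j < n" "v ! i < v ! j" and w: "w = v[i := v ! j, j := v ! i]"
    using assms by (auto simp: bruhat_covered_def)
  have n: "length v = n" using assms by (simp add: bruhat_covered_def length_perms)
  show ?thesis
    unfolding prefix_le_def
  proof (intro allI impI)
    fix p assume "p < length w"
    \<comment> \<open>Position \<open>i\<close> of \<open>v\<close> is the witness at both exchanged
      positions; elsewhere it is \<open>p\<close> itself.\<close>
    then show "\<exists>q\<le>p. v ! q \<le> w ! p"
      using ij n by (cases "p = i \<or> p = j") (auto simp: w nth_list_update intro: exI[of _ i])
  qed
qed

lemma bruhat_le_imp_prefix_le: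
  assumes "bruhat_le n v w" "v \<in> perms n"
  shows "prefix_le v w"
  using assms(1) unfolding bruhat_le_def
proof (induction rule: rtranclp_induct)
  case base
  show ?case by (auto simp: prefix_le_def)
next
  case (step x y)
  then have "length x = length y" by (auto simp: bruhat_covered_def length_perms)
  with step show ?case using bruhat_covered_prefix_le prefix_le_trans by blast
qed

text \<open>Each cover adds one inversion, so the count grows along every chain; antisymmetry
  follows.\<close>

lemma bruhat_le_inversions:
  assumes "bruhat_le n v w" "v \<noteq> w"
  shows "card (inversions v) < card (inversions w)"
  using assms unfolding bruhat_le_def
proof (induction rule: rtranclp_induct)
  case (step x y)
  then show ?case by (cases "v = x") (auto simp: bruhat_covered_def)
qed simp

lemma bruhat_le_antisym:
  "bruhat_le n v w \<Longrightarrow> bruhat_le n w v \<Longrightarrow> v = w"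
  using bruhat_le_inversions by (metis less_asym)

text \<open>The point is that \<open>v ! d\<close> is the least letter not used earlier that is at least the minimum of
  the first \<open>d + 1\<close> entries: a smaller one would occur later and complete a 132 pattern.\<close>

lemma prefix_le_first_difference:
  assumes "v \<in> perms n" "w \<in> perms n" "avoids_132 v" "prefix_le v w"
    and d: "d < n" "v ! d \<noteq> w ! d" "\<And>p. p < d \<Longrightarrow> v ! p = w ! p"
  shows "v ! d < w ! d"
proof (rule ccontr)
  assume "\<not> v ! d < w ! d"
  with d have lt: "w ! d < v ! d" by simp
  have len: "length v = n" "length w = n" and set: "set w = set v"
    and dist: "distinct v" "distinct w"
    using assms by (simp_all add: length_perms permutations_of_set_def)
  obtain q where q: "q \<le> d" "v ! q \<le> w ! d" using assms(4) d len by (auto simp: prefix_le_def)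
  have "w ! d \<in> set v" using d len set by (metis nth_mem)
  then obtain k where k: "k < n" "v ! k = w ! d" using len by (auto simp: in_set_conv_nth)
  have "d < k"
  proof (rule ccontr)
    assume "\<not> d < k"
    with k lt have "k < d" by (cases "k = d") auto
    with k d have "w ! k = w ! d" by simp
    with \<open>k < d\<close> d len dist show False using nth_eq_iff_index_eq[of w k d] by simp
  qed
  have "q \<noteq> d" using q lt by auto
  then have "q < d" using q by simp
  moreover have "v ! q \<noteq> v ! k"
    using dist len k \<open>d < k\<close> \<open>q < d\<close> nth_eq_iff_index_eq[of v q k] by simp
  \<comment> \<open>Now \<open>q < d < k\<close> and \<open>v ! q < v ! k < v ! d\<close>, a 132
    pattern.\<close>
  ultimately show False
    using assms(3) \<open>d < k\<close> k lt q len unfolding avoids_132_def by (metis le_neq_implies_less)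
qed

text \<open>Induction descending from \<open>w\<close> by one cover at a time. It runs over all
  permutations \<open>w\<close> because the words met on the way down may contain 132.\<close>

lemma prefix_le_imp_bruhat_le:
  assumes "v \<in> perms n" "avoids_132 v"
  shows "w \<in> perms n \<Longrightarrow> prefix_le v w \<Longrightarrow> bruhat_le n v w"
proof (induction "card (inversions w)" arbitrary: w rule: less_induct)
  case less
  note w = less.prems(1)
  have len: "length v = n" "length w = n" and set: "set w = set v"
    and dist: "distinct v" "distinct w"
    using assms w by (simp_all add: length_perms permutations_of_set_def)
  show ?case
  proof (cases "v = w")
    case True
    then show ?thesis by (simp add: bruhat_le_def)
  next
    case False
    then have "\<exists>d. d < n \<and> v ! d \<noteq> w ! d" using len by (metis nth_equalityI)
    then obtain d where d: "d < n" "v ! d \<noteq> w ! d" "\<And>p. p < d \<Longrightarrow> v ! p = w ! p"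
      using exists_least_iff[of "\<lambda>d. d < n \<and> v ! d \<noteq> w ! d"] by force
    have vd: "v ! d < w ! d"
      using prefix_le_first_difference assms w less.prems(2) d by blast
    have "v ! d \<in> set w" using d len set by (metis nth_mem)
    then obtain j where j: "j < n" "w ! j = v ! d" using len by (auto simp: in_set_conv_nth)
    have "d < j"
    proof (rule ccontr)
      assume "\<not> d < j"
      with j d have "j < d" by (cases "j = d") auto
      with d j have "v ! j = v ! d" by simp
      with \<open>j < d\<close> d len dist show False using nth_eq_iff_index_eq[of v j d] by simp
    qed
    \<comment> \<open>With the last position \<open>i\<close> before \<open>j\<close> carrying a larger letter, no letter in between has an
      intermediate value, so exchanging \<open>i\<close> and \<open>j\<close> removes exactly one inversion.\<close>
    define S where "S = {p. d \<le> p \<and> p < j \<and> v ! d < w ! p}"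
    define i where "i = Max S"
    have "finite S" by (auto simp: S_def)
    moreover have "d \<in> S" using \<open>d < j\<close> vd by (simp add: S_def)
    ultimately have "i \<in> S" and max: "\<And>p. p \<in> S \<Longrightarrow> p \<le> i"
      unfolding i_def by (auto intro: Max_in)
    then have i: "d \<le> i" "i < j" "v ! d < w ! i" by (simp_all add: S_def)
    define u where "u = w[i := w ! j, j := w ! i]"
    have u: "u \<in> perms n"
      using w i j len set_swap[of i w j] distinct_swap[of i w j]
      by (simp add: u_def permutations_of_set_def)
    have u_nth: "u ! p = (if p = i then w ! j else if p = j then w ! i else w ! p)" if "p < n" for p
      using that i len by (auto simp: u_def nth_list_update)
    \<comment> \<open>Read from \<open>u\<close> the same exchange is ascending,
      \<open>u ! i = v ! d < u ! j\<close>, so the count of inversions applies with \<open>u\<close>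
      as the lower word.\<close>
    have wu: "w = u[i := u ! j, j := u ! i]"
      using i j len u by (intro nth_equalityI) (auto simp: nth_list_update u_nth length_perms)
    have card: "card (inversions w) = card (inversions u) + 1"
      unfolding wu
    proof (rule inversions_swap_card)
      fix k assume k: "i < k" "k < j"
      then have "\<not> v ! d < w ! k" using max[of k] i by (auto simp: S_def)
      then show "\<not> (u ! i < u ! k \<and> u ! k < u ! j)" using k i j by (simp add: u_nth)
    qed (use i j u in \<open>auto simp: u_nth length_perms permutations_of_set_def\<close>)
    have "prefix_le v u"
      unfolding prefix_le_def
    proof (intro allI impI)
      fix p assume "p < length u"
      then have p: "p < n" using u by (simp add: length_perms)
      show "\<exists>q\<le>p. v ! q \<le> u ! p"
      proof (cases "p = i \<or> p = j")
        case True
        \<comment> \<open>Both positions are at or after \<open>d\<close> and carry letters at least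
          \<open>v ! d\<close>, so \<open>d\<close> is the witness.\<close>
        then have "d \<le> p" "v ! d \<le> u ! p" using i j p by (auto simp: u_nth)
        then show ?thesis by blast
      next
        case False
        then show ?thesis using p less.prems(2) len by (auto simp: u_nth prefix_le_def)
      qed
    qed
    then have "bruhat_le n v u" using less.hyps card u by simp
    moreover have "bruhat_covered n u w"
      unfolding bruhat_covered_def using u w i j card
      by (intro conjI exI[of _ i] exI[of _ j] wu) (simp_all add: u_nth)
    ultimately show ?thesis by (simp add: bruhat_le_def)
  qed
qed

section \<open>Right steps preceding the up steps\<close>

lemma rights_before_ups_Nil [simp]: "rights_before_ups [] = []"
  by (simp add: rights_before_ups_def)

lemma rights_before_ups_append:
  "rights_before_ups (p @ q) =
     rights_before_ups p @ map (\<lambda>k. count_list p Rt + k) (rights_before_ups q)"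
proof -
  let ?U = "\<lambda>w. filter (\<lambda>i. w ! i = Up) [0..<length w]"
  have "map (\<lambda>i. i + length p) [0..<length q] = [length p..<length p + length q]"
    using map_add_upt[of "length p" "length q"] by (simp only: add.commute)
  then have "[0..<length (p @ q)] = [0..<length p] @ map (\<lambda>i. i + length p) [0..<length q]"
    using upt_add_eq_append[of 0 "length p" "length q"] by simp
  moreover have "filter (\<lambda>i. (p @ q) ! i = Up) [0..<length p] = ?U p"
    by (intro filter_cong) (auto simp: nth_append)
  moreover have "filter (\<lambda>i. (p @ q) ! i = Up) (map (\<lambda>i. i + length p) [0..<length q]) =
      map (\<lambda>i. i + length p) (?U q)"
    by (simp add: filter_map o_def nth_append)
  ultimately have "?U (p @ q) = ?U p @ map (\<lambda>i. i + length p) (?U q)"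
    by (simp only: filter_append)
  moreover have "map (\<lambda>i. count_list (take i (p @ q)) Rt) (?U p) =
      map (\<lambda>i. count_list (take i p) Rt) (?U p)"
    by (intro map_cong) auto
  ultimately show ?thesis
    by (simp only: rights_before_ups_def map_append map_map) (simp add: o_def)
qed

text \<open>One level of the recursion of \<open>dyck\<close>: the up steps of \<open>q\<close> come
  after all of \<open>p\<close> and the separating \<open>Rt\<close>, hence the shift with
  \<open>Suc\<close>.\<close>

lemma rights_before_ups_Up_Rt:
  "rights_before_ups (Up # p @ Rt # q) =
     0 # rights_before_ups p @ map (\<lambda>k. Suc (count_list p Rt) + k) (rights_before_ups q)"
proof -
  have "rights_before_ups [Up] = [0]" "rights_before_ups [Rt] = []"
    by (simp_all add: rights_before_ups_def)
  then show ?thesis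
    using rights_before_ups_append[of "[Up]" "p @ Rt # q"]
      rights_before_ups_append[of p "[Rt] @ q"] rights_before_ups_append[of "[Rt]" q]
    by (simp add: o_def)
qed

lemma split_at_Max:
  fixes w :: "nat list"
  assumes "w \<noteq> []" "distinct w"
  obtains L R where "w = L @ Max (set w) # R"
    "dyck w = Up # dyck (standardize L) @ Rt # dyck (standardize R)"
proof -
  define M where "M = Max (set w)"
  have "M \<in> set w" using assms by (simp add: M_def)
  then obtain L R where w: "w = L @ M # R" "M \<notin> set L"
    by (meson split_list_first)
  have "takeWhile (\<lambda>x. x \<noteq> M) (L @ M # R) = L"
    using w(2) by (induction L) auto
  moreover have "tl (dropWhile (\<lambda>x. x \<noteq> M) (L @ M # R)) = R"
    using w(2) by (induction L) auto
  ultimately show thesis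
    using that[of L R] w(1) dyck.simps(2)[OF assms(1)] unfolding M_def[symmetric] by simp
qed

section \<open>First entries below a threshold\<close>

text \<open>If some entry is at most \<open>a\<close>, this is the position, counted from 0, of the
  first one; otherwise it is \<open>length w\<close>.\<close>

definition above :: "nat list \<Rightarrow> nat \<Rightarrow> nat" where
  "above w a = length (takeWhile (\<lambda>x. a < x) w)"

lemma above_le_iff:
  assumes "p < length w"
  shows "above w a \<le> p \<longleftrightarrow> (\<exists>q\<le>p. w ! q \<le> a)"
proof
  assume "above w a \<le> p"
  \<comment> \<open>As \<open>p < length w\<close>, the value \<open>above w a\<close> is a genuine
    position, the one where \<open>takeWhile\<close> stops.\<close>
  moreover from this have "\<not> a < w ! above w a"
    using assms nth_length_takeWhile[of "\<lambda>x. a < x" w] by (simp add: above_def)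
  ultimately show "\<exists>q\<le>p. w ! q \<le> a" by (metis linorder_not_less)
next
  assume "\<exists>q\<le>p. w ! q \<le> a"
  then obtain q where q: "q \<le> p" "w ! q \<le> a" by blast
  have "above w a \<le> q"
  proof (rule ccontr)
    assume "\<not> above w a \<le> q"
    then have "q < length (takeWhile (\<lambda>x. a < x) w)" by (simp add: above_def)
    then have "a < w ! q" by (metis nth_mem set_takeWhileD takeWhile_nth)
    with q show False by simp
  qed
  with q show "above w a \<le> p" by simp
qed

text \<open>Both sides say that the first entry at most \<open>a\<close> comes in \<open>v\<close>
  no later than in \<open>w\<close>. Position \<open>p\<close> is tested by the threshold
  \<open>w ! p\<close>, so letters of \<open>w\<close> suffice.\<close>

lemma prefix_le_iff_above:
  assumes "length v = length w"
  shows "prefix_le v w \<longleftrightarrow> (\<forall>a\<in>set w. above v a \<le> above w a)"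
proof
  assume L: "prefix_le v w"
  show "\<forall>a\<in>set w. above v a \<le> above w a"
  proof
    fix a assume "a \<in> set w"
    then obtain p where "p < length w" "w ! p = a" by (auto simp: in_set_conv_nth)
    then have lt: "above w a < length w" using above_le_iff[of p w a] by fastforce
    then obtain q where "q \<le> above w a" "w ! q \<le> a" using above_le_iff[of "above w a" w a] by auto
    moreover from this lt obtain r where "r \<le> q" "v ! r \<le> w ! q"
      using L unfolding prefix_le_def by (metis le_less_trans)
    ultimately have "\<exists>r\<le>above w a. v ! r \<le> a" by (meson le_trans)
    then show "above v a \<le> above w a" using above_le_iff[of "above w a" v a] lt assms by simp
  qed
next
  assume R: "\<forall>a\<in>set w. above v a \<le> above w a"
  show "prefix_le v w"
    unfolding prefix_le_def
  proof (intro allI impI)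
    fix p assume p: "p < length w"
    then have "above w (w ! p) \<le> p" using above_le_iff[of p w "w ! p"] by auto
    then have "above v (w ! p) \<le> p" using R p by (meson le_trans nth_mem)
    then show "\<exists>q\<le>p. v ! q \<le> w ! p" using above_le_iff[of p v "w ! p"] p assms by simp
  qed
qed

section \<open>132-avoiding words and their Dyck words\<close>

text \<open>Makes standardization an order-preserving relabelling, under which avoidance, sorting
  and \<open>above\<close> are transferred below.\<close>

lemma strict_mono_on_standardize:
  fixes w :: "nat list"
  shows "strict_mono_on (set w) (\<lambda>x. card {y \<in> set w. y \<le> x})"
proof (rule strict_mono_onI)
  fix r s assume "r \<in> set w" "s \<in> set w" "r < s"
  then have "{y \<in> set w. y \<le> r} \<subset> {y \<in> set w. y \<le> s}"
    by (auto simp: psubset_eq set_eq_iff intro!: exI[of _ s])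
  then show "card {y \<in> set w. y \<le> r} < card {y \<in> set w. y \<le> s}"
    by (intro psubset_card_mono) auto
qed

lemma avoids_132_append:
  assumes "avoids_132 (xs @ ys)"
  shows "avoids_132 xs" "avoids_132 ys"
proof -
  show "avoids_132 xs"
    unfolding avoids_132_def
  proof clarify
    fix i j k assume "i < j" "j < k" "k < length xs" "xs ! i < xs ! k" "xs ! k < xs ! j"
    then show False using assms unfolding avoids_132_def
      by (elim notE, intro exI[of _ i] exI[of _ j] exI[of _ k]) (simp add: nth_append)
  qed
  show "avoids_132 ys"
    unfolding avoids_132_def
  proof clarify
    fix i j k assume "i < j" "j < k" "k < length ys" "ys ! i < ys ! k" "ys ! k < ys ! j"
    then show False using assms unfolding avoids_132_def
      by (elim notE, intro exI[of _ "length xs + i"] exI[of _ "length xs + j"]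
          exI[of _ "length xs + k"]) (simp add: nth_append)
  qed
qed

lemma avoids_132_map:
  assumes "avoids_132 w" "strict_mono_on (set w) f"
  shows "avoids_132 (map f w)"
  unfolding avoids_132_def
proof clarify
  fix i j k assume ijk: "i < j" "j < k" "k < length (map f w)"
    and lt: "map f w ! i < map f w ! k" "map f w ! k < map f w ! j"
  then have "w ! i < w ! k" "w ! k < w ! j"
    using strict_mono_on_less[OF assms(2), of "w ! i" "w ! k"]
      strict_mono_on_less[OF assms(2), of "w ! k" "w ! j"] by simp_all
  with assms(1) ijk show False unfolding avoids_132_def by auto
qed

text \<open>A letter of \<open>L\<close>, then \<open>M\<close>, then a larger letter of
  \<open>R\<close> would form a 132 pattern.\<close>

lemma avoids_132_across_Max:
  assumes "avoids_132 (L @ M # R)" "distinct (L @ M # R)" "\<forall>x\<in>set (L @ M # R). x \<le> M"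
    and "x \<in> set L" "y \<in> set R"
  shows "y < x"
proof (rule ccontr)
  assume "\<not> y < x"
  moreover have "x \<noteq> y" "y \<noteq> M" "y \<le> M" using assms by auto
  ultimately have "x < y" "y < M" by simp_all
  obtain i k where "i < length L" "L ! i = x" "k < length R" "R ! k = y"
    using assms(4,5) by (auto simp: in_set_conv_nth)
  then show False
    using assms(1) \<open>x < y\<close> \<open>y < M\<close> unfolding avoids_132_def
    by (elim notE, intro exI[of _ i] exI[of _ "length L"] exI[of _ "length L + Suc k"])
      (simp add: nth_append)
qed

lemma sort_map_strict_mono_on:
  fixes f :: "nat \<Rightarrow> nat"
  assumes "strict_mono_on (set w) f"
  shows "sort (map f w) = map f (sort w)"
proof (rule properties_for_sort)
  have "sorted_wrt (\<lambda>x y. f x \<le> f y) (sort w)"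
    using assms by (intro sorted_wrt_mono_rel[OF _ sorted_sort]) (auto simp: strict_mono_on_leD)
  then show "sorted (map f (sort w))" by (simp add: sorted_wrt_map)
qed simp

lemma above_map_strict_mono_on:
  assumes "strict_mono_on (set w) f" "a \<in> set w"
  shows "above (map f w) (f a) = above w a"
  unfolding above_def takeWhile_map length_map
  using assms by (intro arg_cong[where f = length] takeWhile_cong)
    (auto simp: strict_mono_on_less)

text \<open>The number of right steps is proved along with the main claim because for
  \<open>L\<close> it is the shift applied to the up steps of \<open>R\<close>.\<close>

lemma dyck_above:
  assumes "distinct w" "avoids_132 w"
  shows "count_list (dyck w) Rt = length w \<and>
    rights_before_ups (dyck w) = map (above w) (rev (sort w))"
  using assms
proof (induction "length w" arbitrary: w rule: less_induct)
  case less
  show ?case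
  proof (cases "w = []")
    case True
    then show ?thesis by simp
  next
    case False
    define M where "M = Max (set w)"
    obtain L R where w: "w = L @ M # R"
      and dyck: "dyck w = Up # dyck (standardize L) @ Rt # dyck (standardize R)"
      using split_at_Max[OF False less.prems(1)] unfolding M_def by blast
    have le: "\<forall>x\<in>set w. x \<le> M" by (simp add: M_def)
    have RL: "y < x" if "x \<in> set L" "y \<in> set R" for x y
      using avoids_132_across_Max[of L M R x y] less.prems le that unfolding w by blast
    have avoids: "avoids_132 L" "avoids_132 R"
      using less.prems(2) avoids_132_append[of L "M # R"] avoids_132_append[of "[M]" R]
      unfolding w by auto
    \<comment> \<open>The induction hypothesis for \<open>standardize u\<close>, carried back to the
      letters of \<open>u\<close>.\<close>
    have *: "count_list (dyck (standardize u)) Rt = length u \<and>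
        rights_before_ups (dyck (standardize u)) = map (above u) (rev (sort u))"
      if u: "length u < length w" "distinct u" "avoids_132 u" for u
    proof -
      define f where "f x = card {y \<in> set u. y \<le> x}" for x
      have f: "strict_mono_on (set u) f"
        unfolding f_def by (rule strict_mono_on_standardize)
      have st: "standardize u = map f u" by (simp add: standardize_def f_def)
      have "distinct (map f u)"
        using u f by (simp add: distinct_map strict_mono_on_imp_inj_on)
      moreover have "avoids_132 (map f u)" using avoids_132_map u f by blast
      ultimately show ?thesis
        using less.hyps[of "map f u"] u unfolding st
        by (simp add: sort_map_strict_mono_on[OF f] rev_map above_map_strict_mono_on[OF f])
    qed
    have L: "count_list (dyck (standardize L)) Rt = length L"
        "rights_before_ups (dyck (standardize L)) = map (above L) (rev (sort L))"
      and R: "count_list (dyck (standardize R)) Rt = length R"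
        "rights_before_ups (dyck (standardize R)) = map (above R) (rev (sort R))"
      using *[of L] *[of R] less.prems(1) avoids w by simp_all
    \<comment> \<open>Decreasingly: \<open>M\<close>, then the letters of \<open>L\<close>, then
      those of \<open>R\<close>, as in the recursion for the up steps.\<close>
    have sort: "sort w = sort R @ sort L @ [M]"
      using RL le unfolding w
      by (intro properties_for_sort) (auto simp: sorted_append less_imp_le)
    have "above w M = 0"
      using le unfolding w by (cases L) (auto simp: above_def)
    \<comment> \<open>The prefix ends inside \<open>L\<close>, at the letter \<open>a\<close> at the
      latest.\<close>
    moreover have "above w a = above L a" if "a \<in> set L" for a
      unfolding w above_def using that by (subst takeWhile_append1[of a]) auto
    \<comment> \<open>All of \<open>L\<close> and \<open>M\<close> exceed \<open>a\<close>, which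
      gives the shift \<open>Suc (length L)\<close>.\<close>
    moreover have "above w a = Suc (length L) + above R a" if "a \<in> set R" for a
    proof -
      have "a < M" using that le less.prems(1) unfolding w by (auto simp: le_less)
      then show ?thesis
        unfolding w above_def using RL that by (subst takeWhile_append2) auto
    qed
    ultimately have "map (above w) (rev (sort w)) = 0 # map (above L) (rev (sort L)) @
        map (\<lambda>k. Suc (length L) + k) (map (above R) (rev (sort R)))"
      by (simp add: sort)
    moreover have "count_list (dyck w) Rt = length w"
      using L R by (simp add: dyck) (simp add: w)
    ultimately show ?thesis
      using L R by (simp only: dyck rights_before_ups_Up_Rt)
  qed
qed

lemma Lam_eq_above:
  assumes "n \<ge> 1" "w \<in> perms n" "avoids_132 w"
  shows "Lam w = map (above w) [1..<n]"
proof -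
  have "distinct w" "set w = {1..n}" using assms(2) by (simp_all add: permutations_of_set_def)
  then have "sort w = [1..<Suc n]"
    by (intro sorted_distinct_set_unique) (simp_all only: sorted_sort distinct_sort set_sort
      sorted_upt distinct_upt set_upt atLeastLessThanSuc_atLeastAtMost)
  \<comment> \<open>The leading \<open>n\<close> is the entry dropped by \<open>tl\<close>; the
    reversal in \<open>Lam\<close> makes the remaining letters increasing.\<close>
  then have "rev (sort w) = n # rev [1..<n]" using assms(1) by simp
  then show ?thesis
    using dyck_above[OF \<open>distinct w\<close> assms(3)] by (simp add: Lam_def rev_map)
qed

section \<open>Containment of diagrams\<close>

lemma young_diagram_subset_iff:
  assumes "length \<mu> = length \<nu>"
  shows "young_diagram \<mu> \<subseteq> young_diagram \<nu> \<longleftrightarrow> (\<forall>i<length \<mu>. \<mu> ! i \<le> \<nu> ! i)"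
proof
  assume "young_diagram \<mu> \<subseteq> young_diagram \<nu>"
  then have "j < \<nu> ! i" if "i < length \<mu>" "j < \<mu> ! i" for i j
    using that by (auto simp: young_diagram_def)
  \<comment> \<open>If \<open>\<nu> ! i < \<mu> ! i\<close>, the cell with
    \<open>j = \<nu> ! i\<close> would give \<open>j < j\<close>.\<close>
  then show "\<forall>i<length \<mu>. \<mu> ! i \<le> \<nu> ! i" using linorder_not_less by blast
qed (use assms in \<open>auto simp: young_diagram_def intro: less_le_trans\<close>)

lemma young_diagram_Lam_subset_iff:
  assumes "n \<ge> 1" "v \<in> perms n" "avoids_132 v" "w \<in> perms n" "avoids_132 w"
  shows "young_diagram (Lam v) \<subseteq> young_diagram (Lam w) \<longleftrightarrow> bruhat_le n v w"
proof -
  have set: "set w = {1..n}" and len: "length v = length w"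
    using assms by (simp_all add: permutations_of_set_def length_perms)
  have "v \<noteq> []" "\<forall>x\<in>set v. x \<le> n"
    using assms by (auto simp: permutations_of_set_def)
  \<comment> \<open>The letter \<open>n\<close> has no part in \<open>Lam\<close>, and its
    comparison is trivial; part \<open>i\<close> belongs to the letter \<open>Suc i\<close>.\<close>
  then have "above v n = 0" by (cases v) (auto simp: above_def)
  have "young_diagram (Lam v) \<subseteq> young_diagram (Lam w) \<longleftrightarrow>
      (\<forall>i<n - 1. above v (Suc i) \<le> above w (Suc i))"
    using assms by (simp add: Lam_eq_above young_diagram_subset_iff)
  also have "\<dots> \<longleftrightarrow> (\<forall>a\<in>{1..n}. above v a \<le> above w a)"
  proof
    assume L: "\<forall>i<n - 1. above v (Suc i) \<le> above w (Suc i)"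
    show "\<forall>a\<in>{1..n}. above v a \<le> above w a"
    proof
      fix a assume "a \<in> {1..n}"
      then show "above v a \<le> above w a"
        using L[rule_format, of "a - 1"] \<open>above v n = 0\<close> by (cases "a = n") auto
    qed
  qed auto
  also have "\<dots> \<longleftrightarrow> prefix_le v w" using prefix_le_iff_above[OF len] set by simp
  also have "\<dots> \<longleftrightarrow> bruhat_le n v w"
    using bruhat_le_imp_prefix_le prefix_le_imp_bruhat_le assms by blast
  finally show ?thesis .
qed

theorem proposition3p3:
  fixes n :: nat and \<pi> \<sigma> :: "nat list"
  assumes "n \<ge> 1"
    and "\<pi> \<in> perms n" and "avoids_132 \<pi>"
    and "\<sigma> \<in> perms n" and "avoids_132 \<sigma>"
  shows "young_diagram (Lam \<pi>) \<subset> young_diagram (Lam \<sigma>) \<longleftrightarrow> bruhat_less n \<pi> \<sigma>"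
proof -
  \<comment> \<open>Antisymmetry gives the strict order the form of proper containment, so the weak
    equivalence is used in both directions.\<close>
  have "bruhat_less n \<pi> \<sigma> \<longleftrightarrow> bruhat_le n \<pi> \<sigma> \<and> \<not> bruhat_le n \<sigma> \<pi>"
    using bruhat_le_antisym[of n \<pi> \<sigma>] by (auto simp: bruhat_less_def bruhat_le_def)
  then show ?thesis
    using young_diagram_Lam_subset_iff[OF assms] young_diagram_Lam_subset_iff[OF assms(1,4,5,2,3)]
    by (simp add: less_le_not_le[of "young_diagram (Lam \<pi>)"])
qed

end
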